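(* Let $X$ be a countable, second countable topological space. Then $\mathcal{M}(X)$ is a $\boldsymbol{\Pi}^0_3$ subset of $\mathcal{P}(X)$.
   Context: "Countable" means countably infinite (the paper writes "at most countable" when finite sets are allowed). For a topological space $X$, a subset $A\subseteq X$ is dense in an open set $U$ if $U\subseteq\overline{A}$, and codense in $U$ if $U\subseteq\overline{X\setminus A}$. A subset $A\subseteq X$ is monitorable if for every non-empty open set $U\subseteq X$ either $A$ is not dense in $U$ or $A$ is not codense in $U$. $\mathcal{M}(X)\subseteq\mathcal{P}(X)$ denotes the family of monitorable subsets of $X$. The powerset $\mathcal{P}(X)$ is identified with $2^X$ via characteristic functions and carries the product topology (with $2=\{0,1\}$ discrete); for countable $X$ it is homeomorphic to the Cantor space. $\boldsymbol{\Sigma}^0_\alpha,\boldsymbol{\Pi}^0_\alpha$ are the usual classes of the Borel hierarchy: $\boldsymbol{\Sigma}^0_1(Z)$ is the family of open sets of $Z$, $\boldsymbol{\Pi}^0_\alpha(Z)$ is the family of complements of $\boldsymbol{\Sigma}^0_\alpha(Z)$ sets, and for $\alpha\ge2$, $\boldsymbol{\Sigma}^0_\alpha(Z)$ consists of the at most countable unions of members of $\bigcup_{\beta<\alpha}\boldsymbol{\Pi}^0_\beta(Z)$. *)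

theory Defs
  imports "HOL-Analysis.Analysis"
begin

(* The library has second countability only as a type class; no separation axiom is implied. *)
definition second_countable_space :: "'a topology \<Rightarrow> bool" where
  "second_countable_space X \<longleftrightarrow>
     (\<exists>\<B>. countable \<B> \<and> (\<forall>V\<in>\<B>. openin X V) \<and>
          (\<forall>U x. openin X U \<and> x \<in> U \<longrightarrow> (\<exists>V\<in>\<B>. x \<in> V \<and> V \<subseteq> U)))"

definition dense_in_open :: "'a topology \<Rightarrow> 'a set \<Rightarrow> 'a set \<Rightarrow> bool" where
  "dense_in_open X A U \<longleftrightarrow> U \<subseteq> X closure_of A"

definition codense_in_open :: "'a topology \<Rightarrow> 'a set \<Rightarrow> 'a set \<Rightarrow> bool" where
  "codense_in_open X A U \<longleftrightarrow> U \<subseteq> X closure_of (topspace X - A)"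

definition monitorable_sets :: "'a topology \<Rightarrow> 'a set set" where
  "monitorable_sets X =
     {A. A \<subseteq> topspace X \<and>
         (\<forall>U. openin X U \<and> U \<noteq> {} \<longrightarrow> \<not> dense_in_open X A U \<or> \<not> codense_in_open X A U)}"

(* The points of the library's product topology are functions that are undefined outside the
   index set, so the characteristic function of a subset of S is restricted to S.  On Pow S this
   map is a bijection onto the product 2^S, and powerset_topology S transports the product
   topology along it. *)
definition char_fun :: "'a set \<Rightarrow> 'a set \<Rightarrow> 'a \<Rightarrow> bool" where
  "char_fun S A = restrict (\<lambda>x. x \<in> A) S"

definition powerset_topology :: "'a set \<Rightarrow> 'a set topology" where
  "powerset_topology S =
     pullback_topology (Pow S) (char_fun S)
       (product_topology (\<lambda>_. discrete_topology (UNIV :: bool set)) S)"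

(* The finite levels of the Borel hierarchy; they start at 1, and level 0 is a dummy value. *)
fun borel_Sigma :: "'a topology \<Rightarrow> nat \<Rightarrow> 'a set set" where
  "borel_Sigma Z 0 = {}"
| "borel_Sigma Z (Suc 0) = {U. openin Z U}"
| "borel_Sigma Z (Suc (Suc n)) =
     {\<Union>\<C> |\<C>. countable \<C> \<and>
        \<C> \<subseteq> (\<Union>k\<in>{1..Suc n}. (\<lambda>S. topspace Z - S) ` borel_Sigma Z k)}"

definition borel_Pi :: "'a topology \<Rightarrow> nat \<Rightarrow> 'a set set" where
  "borel_Pi Z n = (\<lambda>S. topspace Z - S) ` borel_Sigma Z n"

end

(* A set A fails to be monitorable iff some non-empty basic open set U lies in the closures of both
   A and its complement.  For fixed U this says that every basic V meeting U meets both A and its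
   complement, and each of these countably many conditions on A is open.  So the non-monitorable
   sets form a countable union of G-delta sets. *)
theory Submission
  imports Defs
begin

lemma topspace_powerset_topology [simp]: "topspace (powerset_topology S) = Pow S"
  by (auto simp: powerset_topology_def topspace_pullback_topology char_fun_def)

text \<open>Evaluation at \<open>x\<close> is a continuous projection to a discrete factor, so the
  preimage of \<open>{b}\<close> is open. Since \<open>x\<close> lies in \<open>S\<close>, the
  restriction in \<open>char_fun\<close> leaves this coordinate equal to membership in
  \<open>A\<close>.\<close>

lemma openin_powerset_topology_coordinate:
  assumes "x \<in> S"
  shows "openin (powerset_topology S) {A \<in> Pow S. (x \<in> A) = b}"
proof -
  let ?P = "product_topology (\<lambda>_. discrete_topology (UNIV :: bool set)) S"
  have "openin ?P {f \<in> topspace ?P. f x \<in> {b}}"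
    by (rule openin_continuous_map_preimage[OF continuous_map_product_projection[OF assms]]) simp
  moreover have "{A \<in> Pow S. (x \<in> A) = b} =
      char_fun S -` {f \<in> topspace ?P. f x \<in> {b}} \<inter> Pow S"
    using assms by (auto simp: char_fun_def)
  ultimately show ?thesis
    unfolding powerset_topology_def openin_pullback_topology by blast
qed

text \<open>One point of \<open>V\<close> inside \<open>A\<close> and one outside witness the
  condition, and each witness constrains a single coordinate. Hence the set is an intersection of
  two unions of open coordinate sets, however large \<open>V\<close> is.\<close>

lemma openin_powerset_topology_splits:
  assumes "V \<subseteq> S"
  shows "openin (powerset_topology S) {A \<in> Pow S. V \<inter> A \<noteq> {} \<and> V - A \<noteq> {}}"
proof -
  have "{A \<in> Pow S. V \<inter> A \<noteq> {} \<and> V - A \<noteq> {}} =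
      (\<Union>x\<in>V. {A \<in> Pow S. (x \<in> A) = True}) \<inter> (\<Union>x\<in>V. {A \<in> Pow S. (x \<in> A) = False})"
    by auto
  moreover have "openin (powerset_topology S) \<dots>"
    using assms
    by (intro openin_Int openin_Union; elim imageE; blast intro: openin_powerset_topology_coordinate)
  ultimately show ?thesis by simp
qed

text \<open>By De Morgan the complement is a countable union of closed sets. Bounding
  \<open>z\<close> by \<open>topspace Z\<close> gives the right value, the whole space, when
  \<open>I\<close> is empty.\<close>

lemma borel_Pi_2_countable_INT:
  assumes "countable I" and "\<And>i. i \<in> I \<Longrightarrow> openin Z (G i)"
  shows "{z \<in> topspace Z. \<forall>i\<in>I. z \<in> G i} \<in> borel_Pi Z 2"
proof -
  let ?C = "(\<lambda>i. topspace Z - G i) ` I"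
  have "countable ?C \<and> ?C \<subseteq> (\<Union>k\<in>{1..Suc 0}. (\<lambda>S. topspace Z - S) ` borel_Sigma Z k)"
    using assms by auto
  then have "\<Union>?C \<in> borel_Sigma Z 2"
    unfolding numeral_2_eq_2 borel_Sigma.simps by blast
  moreover have "{z \<in> topspace Z. \<forall>i\<in>I. z \<in> G i} = topspace Z - \<Union>?C"
    by auto
  ultimately show ?thesis
    unfolding borel_Pi_def by blast
qed

lemma borel_Pi_3_Diff_countable_UN:
  assumes "countable I" and "\<And>i. i \<in> I \<Longrightarrow> F i \<in> borel_Pi Z 2"
  shows "topspace Z - (\<Union>i\<in>I. F i) \<in> borel_Pi Z 3"
proof -
  \<comment> \<open>All members of the family enter the union at level \<open>k = 2\<close>, the top
    of the permitted range.\<close>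
  have "countable (F ` I) \<and>
      F ` I \<subseteq> (\<Union>k\<in>{1..Suc (Suc 0)}. (\<lambda>S. topspace Z - S) ` borel_Sigma Z k)"
    using assms by (force simp: borel_Pi_def numeral_2_eq_2)
  then have "\<Union>(F ` I) \<in> borel_Sigma Z 3"
    unfolding numeral_3_eq_3 borel_Sigma.simps by blast
  then show ?thesis
    unfolding borel_Pi_def by blast
qed

text \<open>A basic set meeting \<open>U\<close> is a neighbourhood of some point of
  \<open>U\<close>; conversely, every neighbourhood of a point of \<open>U\<close> contains a basic
  one. So density in \<open>U\<close> becomes a condition quantified over \<open>\<B>\<close>
  alone.\<close>

lemma subset_closure_of_base_iff:
  assumes B: "\<forall>V\<in>\<B>. openin X V"
    and base: "\<forall>W x. openin X W \<and> x \<in> W \<longrightarrow> (\<exists>V\<in>\<B>. x \<in> V \<and> V \<subseteq> W)"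
    and U: "U \<subseteq> topspace X"
  shows "U \<subseteq> X closure_of A \<longleftrightarrow> (\<forall>V\<in>\<B>. V \<inter> U \<noteq> {} \<longrightarrow> V \<inter> A \<noteq> {})"
proof
  assume "U \<subseteq> X closure_of A"
  then show "\<forall>V\<in>\<B>. V \<inter> U \<noteq> {} \<longrightarrow> V \<inter> A \<noteq> {}"
    using B unfolding closure_of_def by blast
next
  assume R: "\<forall>V\<in>\<B>. V \<inter> U \<noteq> {} \<longrightarrow> V \<inter> A \<noteq> {}"
  show "U \<subseteq> X closure_of A"
  proof
    fix x assume x: "x \<in> U"
    have "\<exists>y. y \<in> A \<and> y \<in> W" if W: "x \<in> W" "openin X W" for W
    proof -
      obtain V where "V \<in> \<B>" "x \<in> V" "V \<subseteq> W"
        using base W by metis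
      then show ?thesis
        using R x by blast
    qed
    then show "x \<in> X closure_of A"
      using x U by (auto simp: in_closure_of)
  qed
qed

text \<open>Density and codensity are inherited by subsets, and every non-empty open set contains a
  non-empty basic one. Hence a basic \<open>U\<close> can serve as the witness that \<open>A\<close>
  is not monitorable.\<close>

lemma monitorable_sets_base:
  assumes B: "\<forall>V\<in>\<B>. openin X V"
    and base: "\<forall>W x. openin X W \<and> x \<in> W \<longrightarrow> (\<exists>V\<in>\<B>. x \<in> V \<and> V \<subseteq> W)"
  shows "monitorable_sets X = Pow (topspace X) -
    (\<Union>U\<in>\<B> - {{}}. {A \<in> Pow (topspace X).
        \<forall>V\<in>{V \<in> \<B>. V \<inter> U \<noteq> {}}. V \<inter> A \<noteq> {} \<and> V - A \<noteq> {}})"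
proof -
  have sub: "V \<subseteq> topspace X" if "V \<in> \<B>" for V
    using B that by (blast dest: openin_subset)
  have both_dense: "dense_in_open X A U \<and> codense_in_open X A U \<longleftrightarrow>
      (\<forall>V\<in>{V \<in> \<B>. V \<inter> U \<noteq> {}}. V \<inter> A \<noteq> {} \<and> V - A \<noteq> {})" if "U \<in> \<B>" for A U
  proof -
    have "V \<inter> (topspace X - A) = V - A" if "V \<in> \<B>" for V
      using sub[OF that] by blast
    then have "codense_in_open X A U \<longleftrightarrow> (\<forall>V\<in>\<B>. V \<inter> U \<noteq> {} \<longrightarrow> V - A \<noteq> {})"
      unfolding codense_in_open_def subset_closure_of_base_iff[OF B base sub[OF that]]
      by (simp cong: ball_cong)
    moreover have "dense_in_open X A U \<longleftrightarrow> (\<forall>V\<in>\<B>. V \<inter> U \<noteq> {} \<longrightarrow> V \<inter> A \<noteq> {})"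
      unfolding dense_in_open_def subset_closure_of_base_iff[OF B base sub[OF that]] ..
    ultimately show ?thesis
      by simp blast
  qed
  have "(\<exists>U. openin X U \<and> U \<noteq> {} \<and> dense_in_open X A U \<and> codense_in_open X A U) \<longleftrightarrow>
      (\<exists>U\<in>\<B> - {{}}. dense_in_open X A U \<and> codense_in_open X A U)" (is "?L \<longleftrightarrow> ?R") for A
  proof
    assume ?L
    then obtain U x where U: "openin X U" "x \<in> U" "dense_in_open X A U" "codense_in_open X A U"
      by blast
    \<comment> \<open>The point \<open>x\<close> ensures that the smaller basic set \<open>V\<close>
      is non-empty.\<close>
    then obtain V where "V \<in> \<B>" "x \<in> V" "V \<subseteq> U"
      using base by blast
    with U show ?R
      unfolding dense_in_open_def codense_in_open_def by blast
  next
    assume ?R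
    then show ?L using B by blast
  qed
  then have "monitorable_sets X = {A \<in> Pow (topspace X).
      \<not> (\<exists>U\<in>\<B> - {{}}. dense_in_open X A U \<and> codense_in_open X A U)}"
    unfolding monitorable_sets_def by blast
  also have "\<dots> = Pow (topspace X) - (\<Union>U\<in>\<B> - {{}}. {A \<in> Pow (topspace X).
      dense_in_open X A U \<and> codense_in_open X A U})"
    by blast
  also have "\<dots> = Pow (topspace X) - (\<Union>U\<in>\<B> - {{}}. {A \<in> Pow (topspace X).
        \<forall>V\<in>{V \<in> \<B>. V \<inter> U \<noteq> {}}. V \<inter> A \<noteq> {} \<and> V - A \<noteq> {}})"
    by (rule arg_cong[where f = "\<lambda>N. Pow (topspace X) - N"], rule SUP_cong[OF refl])
       (simp only: both_dense Diff_iff)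
  finally show ?thesis .
qed

theorem proposition3p1:
  fixes X :: "'a topology"
  assumes "countable (topspace X)" and "infinite (topspace X)"
    and "second_countable_space X"
  shows "monitorable_sets X \<in> borel_Pi (powerset_topology (topspace X)) 3"
proof -
  obtain \<B> where "countable \<B>" and B: "\<forall>V\<in>\<B>. openin X V"
    and base: "\<forall>W x. openin X W \<and> x \<in> W \<longrightarrow> (\<exists>V\<in>\<B>. x \<in> V \<and> V \<subseteq> W)"
    using assms(3) unfolding second_countable_space_def by blast
  let ?Z = "powerset_topology (topspace X)"
  let ?G = "\<lambda>V. {A \<in> Pow (topspace X). V \<inter> A \<noteq> {} \<and> V - A \<noteq> {}}"
  let ?F = "\<lambda>U. {A \<in> topspace ?Z. \<forall>V\<in>{V \<in> \<B>. V \<inter> U \<noteq> {}}. A \<in> ?G V}"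
  \<comment> \<open>The index set is a subfamily of the countable base, and each \<open>?G V\<close>
    is open in the powerset topology.\<close>
  have "?F U \<in> borel_Pi ?Z 2" for U
    using \<open>countable \<B>\<close>
    by (intro borel_Pi_2_countable_INT openin_powerset_topology_splits)
       (use B openin_subset in auto)
  then have "topspace ?Z - (\<Union>U\<in>\<B> - {{}}. ?F U) \<in> borel_Pi ?Z 3"
    using \<open>countable \<B>\<close> by (intro borel_Pi_3_Diff_countable_UN) auto
  \<comment> \<open>\<open>?F\<close> has the shape of a countable intersection of the open sets
    \<open>?G V\<close>; unfolding \<open>?G\<close> matches it with the sets removed in
    \<open>monitorable_sets_base\<close>.\<close>
  moreover have "?F U = {A \<in> Pow (topspace X).
      \<forall>V\<in>{V \<in> \<B>. V \<inter> U \<noteq> {}}. V \<inter> A \<noteq> {} \<and> V - A \<noteq> {}}" for U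
    by simp blast
  ultimately show ?thesis
    unfolding monitorable_sets_base[OF B base] by (simp only: topspace_powerset_topology)
qed

end
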